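(* Let $G\subsetneq\mathbb{D}$ be a horo-convex domain and $f:\mathbb{D}\to\mathbb{D}$ a holomorphic mapping with $f(\mathbb{D})\subset G$. Then, for $z\in\mathbb{D}$, $$(1-|z|^2)\frac{|f'(z)|}{1-|f(z)|^2}\leq h\big(d_G(f(z))\big),\qquad\text{where } h(t)=\frac{e^{2t}}{\pi}\sin\frac{\pi}{e^{2t}}\quad (t>0).$$ Equality holds at a point if and only if $G$ is a horo-crescent domain and $f$ is a conformal mapping of $\mathbb{D}$ onto $G$.
   Context: $\mathbb{D}=\{z\in\mathbb{C}:|z|<1\}$ and $\mathbb{T}=\partial\mathbb{D}$. A domain is a nonempty open connected set. A horodisk is an open Euclidean disk $H\subset\mathbb{D}$ whose boundary circle is internally tangent to $\mathbb{T}$ at exactly one point. A domain $G\subset\mathbb{D}$ is horo-convex (horocyclically convex) if for every $\omega\in\mathbb{D}\cap\partial G$ there exists a horodisk $H$ such that $\omega\in\partial H$ and $G\cap H=\emptyset$. A horo-crescent is a domain of the form $\mathbb{D}\setminus\overline{H}$ with $H$ a horodisk. The hyperbolic distance of $\mathbb{D}$ is $d_{\mathbb{D}}(z,w)=\operatorname{arctanh}\left|\frac{z-w}{1-\bar z w}\right|$, and for a proper subdomain $G$ of $\mathbb{D}$ and $w\in G$, $d_G(w)=\inf\{d_{\mathbb{D}}(w,\omega):\omega\in\partial G\cap\mathbb{D}\}$ is the hyperbolic distance from $w$ to the boundary of $G$. A conformal mapping is an injective holomorphic map. *)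

theory Defs
  imports "HOL-Complex_Analysis.Complex_Analysis"
begin

abbreviation unit_disk :: "complex set" where
  "unit_disk \<equiv> ball 0 1"

definition is_domain :: "complex set \<Rightarrow> bool" where
  "is_domain G \<longleftrightarrow> G \<noteq> {} \<and> open G \<and> connected G"

(* Since the disk lies inside the unit disk, meeting the unit circle in exactly one
   point is the same as internal tangency; the unit disk itself is excluded. *)
definition horodisk :: "complex set \<Rightarrow> bool" where
  "horodisk H \<longleftrightarrow>
     (\<exists>c r. r > 0 \<and> H = ball c r \<and> H \<subseteq> unit_disk \<and> (\<exists>!p. p \<in> sphere c r \<inter> sphere 0 1))"

definition horo_convex :: "complex set \<Rightarrow> bool" where
  "horo_convex G \<longleftrightarrow>
     is_domain G \<and> G \<subseteq> unit_disk \<and>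
     (\<forall>\<omega> \<in> unit_disk \<inter> frontier G. \<exists>H. horodisk H \<and> \<omega> \<in> frontier H \<and> G \<inter> H = {})"

definition horo_crescent :: "complex set \<Rightarrow> bool" where
  "horo_crescent G \<longleftrightarrow> is_domain G \<and> (\<exists>H. horodisk H \<and> G = unit_disk - closure H)"

definition hyp_dist :: "complex \<Rightarrow> complex \<Rightarrow> real" where
  "hyp_dist z w = artanh (cmod ((z - w) / (1 - cnj z * w)))"

(* Meaningful for a proper subdomain G of the unit disk and w in G: by connectedness of
   the disk, the infimum is then over a nonempty set, and it is bounded below by 0. *)
definition hyp_dist_boundary :: "complex set \<Rightarrow> complex \<Rightarrow> real" where
  "hyp_dist_boundary G w = (INF \<omega> \<in> frontier G \<inter> unit_disk. hyp_dist w \<omega>)"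

definition conformal_onto :: "(complex \<Rightarrow> complex) \<Rightarrow> complex set \<Rightarrow> complex set \<Rightarrow> bool" where
  "conformal_onto f A B \<longleftrightarrow> f holomorphic_on A \<and> inj_on f A \<and> f ` A = B"

definition h :: "real \<Rightarrow> real" where
  "h t = exp (2 * t) / pi * sin (pi / exp (2 * t))"

end

(* The Cayley transform u(w) = (p + w)/(p - w) turns the horodisk H tangent at p into the half plane
   Re u > k and the complement of its closure into the strip 0 < Re u < k, whose Riemann map comes from exp(i pi u/k).
   The invariant form of the Schwarz lemma for this crescent gives the bound sin x/x with
   x = pi Re u(f(z))/k, and ln(k/Re u(w))/2 is the hyperbolic distance from w to the horocycle, so
   the bound equals h of that distance. For general G take H to be the horodisk at a nearest boundary
   point of f(z): then G lies in the crescent of H, and since h is increasing, equality for G forces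
   equality for the crescent. *)

theory Submission
  imports Defs
begin

section \<open>The invariant Schwarz lemma at a zero\<close>

text \<open>Precomposing with the disk automorphism that takes 0 to \<open>z\<close> moves the zero
  to the origin, where the Schwarz lemma applies; the derivative of the automorphism at 0 supplies
  the factor. A zero suffices later because the Riemann map is normalised to vanish at the image of
  \<open>z\<close>.\<close>

lemma Schwarz_Pick_at_zero:
  assumes "g holomorphic_on unit_disk" "g ` unit_disk \<subseteq> unit_disk" "z \<in> unit_disk" "g z = 0"
  shows "(1 - (cmod z)\<^sup>2) * cmod (deriv g z) \<le> 1"
    and "(1 - (cmod z)\<^sup>2) * cmod (deriv g z) = 1 \<longleftrightarrow> conformal_onto g unit_disk unit_disk"
proof -
  \<comment> \<open>With the sign convention of \<open>Moebius_function\<close>, \<open>m\<close> is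
    v -> (v + z) / (1 + cnj z * v), and \<open>n\<close> is its inverse.\<close>
  define m where "m = Moebius_function 0 (-z)"
  define n where "n = Moebius_function 0 z"
  have zlt: "cmod z < 1" using assms by simp
  have mhol: "m holomorphic_on unit_disk" and nhol: "n holomorphic_on unit_disk"
    using zlt by (simp_all add: m_def n_def Moebius_function_holomorphic)
  have mD: "m w \<in> unit_disk" "n w \<in> unit_disk" if "w \<in> unit_disk" for w
    using that zlt by (simp_all add: m_def n_def Moebius_function_norm_lt_1)
  have mn: "m (n w) = w" "n (m w) = w" if "w \<in> unit_disk" for w
    using that zlt by (simp_all add: m_def n_def Moebius_function_compose)
  have m0: "m 0 = z" by (simp add: m_def Moebius_function_of_zero)
  have dm: "(m has_field_derivative of_real (1 - (cmod z)\<^sup>2)) (at 0)"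
    unfolding m_def Moebius_function_simple complex_norm_square of_real_diff
    by (auto intro!: derivative_eq_intros simp: mult.commute)
  define q where "q = g \<circ> m"
  have qhol: "q holomorphic_on unit_disk"
    unfolding q_def using assms mhol mD
    by (intro holomorphic_on_compose_gen) auto
  have qD: "q w \<in> unit_disk" if "w \<in> unit_disk" for w
    using assms(2) mD(1)[OF that] unfolding q_def comp_def by (rule subsetD[OF _ imageI])
  have q0: "q 0 = 0" by (simp add: q_def m0 assms)
  have dg: "(g has_field_derivative deriv g z) (at z)"
    using assms holomorphic_derivI open_ball by blast
  have "(q has_field_derivative deriv g z * of_real (1 - (cmod z)\<^sup>2)) (at 0)"
    unfolding q_def using DERIV_chain[of g "deriv g z" m 0] dg dm by (simp add: m0)
  then have dq: "deriv q 0 = deriv g z * of_real (1 - (cmod z)\<^sup>2)"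
    by (rule DERIV_imp_deriv)
  have pos: "0 < 1 - (cmod z)\<^sup>2" using zlt by (simp add: abs_square_less_1)
  have nq: "cmod (deriv q 0) = (1 - (cmod z)\<^sup>2) * cmod (deriv g z)"
    unfolding dq norm_mult norm_of_real using pos by simp
  have SL: "cmod (deriv q 0) \<le> 1"
    using Schwarz_Lemma(2)[OF qhol q0, of 0] qD by auto
  then show "(1 - (cmod z)\<^sup>2) * cmod (deriv g z) \<le> 1" by (simp add: nq)
  have gq: "g w = q (n w)" if "w \<in> unit_disk" for w
    using that by (simp add: q_def mn)
  show "(1 - (cmod z)\<^sup>2) * cmod (deriv g z) = 1 \<longleftrightarrow> conformal_onto g unit_disk unit_disk"
  proof
    assume "(1 - (cmod z)\<^sup>2) * cmod (deriv g z) = 1"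
    then have "cmod (deriv q 0) = 1" by (simp add: nq)
    then obtain \<alpha> where al: "\<And>w. cmod w < 1 \<Longrightarrow> q w = \<alpha> * w" "cmod \<alpha> = 1"
      using Schwarz_Lemma(3)[OF qhol q0, of 0] qD by auto
    have "\<alpha> \<noteq> 0" using al(2) by auto
    have ga: "g w = \<alpha> * n w" if "w \<in> unit_disk" for w
      using al(1) mD(2)[OF that] gq[OF that] by simp
    have "inj_on g unit_disk"
      by (rule inj_onI) (metis ga \<open>\<alpha> \<noteq> 0\<close> mult_cancel_left mn(1))
    moreover have "unit_disk \<subseteq> g ` unit_disk"
    proof
      fix w assume w: "w \<in> unit_disk"
      then have w': "w / \<alpha> \<in> unit_disk" using al(2) by (simp add: norm_divide)
      have "g (m (w / \<alpha>)) = w"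
        using ga[OF mD(1)[OF w']] mn(2)[OF w'] \<open>\<alpha> \<noteq> 0\<close> by simp
      then show "w \<in> g ` unit_disk" using mD(1)[OF w'] by (metis image_eqI)
    qed
    ultimately show "conformal_onto g unit_disk unit_disk"
      using assms by (auto simp: conformal_onto_def)
  next
    assume "conformal_onto g unit_disk unit_disk"
    then have inj: "inj_on g unit_disk" and onto: "g ` unit_disk = unit_disk"
      by (auto simp: conformal_onto_def)
    have qinj: "inj_on q unit_disk"
      by (rule inj_onI) (metis comp_apply inj inj_on_eq_iff mD(1) mn(2) q_def)
    have qonto: "q ` unit_disk = unit_disk"
    proof
      show "q ` unit_disk \<subseteq> unit_disk" using qD by blast
      show "unit_disk \<subseteq> q ` unit_disk"
      proof
        fix w assume "w \<in> unit_disk"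
        then have "w \<in> g ` unit_disk" by (simp only: onto)
        then obtain v where "v \<in> unit_disk" "w = g v" by (rule imageE)
        then show "w \<in> q ` unit_disk" using gq[of v] mD(2)[of v] by blast
      qed
    qed
    \<comment> \<open>The inverse of a bijective \<open>q\<close> is again a self-map of the disk
      fixing 0, so the Schwarz lemma bounds its derivative too; the two derivatives at 0 have
      product 1.\<close>
    obtain r where r: "r holomorphic_on q ` unit_disk"
      and dr: "\<And>w. w \<in> unit_disk \<Longrightarrow> deriv q w * deriv r (q w) = 1"
      and ri: "\<And>w. w \<in> unit_disk \<Longrightarrow> r (q w) = w"
      using holomorphic_has_inverse[OF qhol open_ball qinj] by metis
    have rhol: "r holomorphic_on unit_disk" using r qonto by simp
    have r0: "r 0 = 0" using ri[of 0] q0 by simp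
    have rD: "cmod (r w) < 1" if "cmod w < 1" for w
    proof -
      have "w \<in> q ` unit_disk" using that qonto by simp
      then show ?thesis using ri by auto
    qed
    have "cmod (deriv r 0) \<le> 1"
      using Schwarz_Lemma(2)[OF rhol r0, of 0] rD by auto
    moreover have "cmod (deriv q 0) * cmod (deriv r 0) = 1"
      using dr[of 0] q0 by (simp flip: norm_mult)
    ultimately have "1 \<le> cmod (deriv q 0)"
      by (metis mult_left_le norm_ge_zero)
    then show "(1 - (cmod z)\<^sup>2) * cmod (deriv g z) = 1" using SL nq by simp
  qed
qed

section \<open>Cayley transform, horocycles and crescents\<close>

text \<open>The Cayley transform sending the boundary point \<open>p\<close> of the disk to infinity; horocycles at
  \<open>p\<close> become vertical lines.\<close>
definition cayley :: "complex \<Rightarrow> complex \<Rightarrow> complex" where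
  "cayley p w = (p + w) / (p - w)"

text \<open>For \<open>cmod p = 1\<close> this is the preimage of the strip 0 < Re u < k; the left
  bound holds on the whole disk by \<open>Re_cayley_pos\<close>.\<close>

definition crescent :: "complex \<Rightarrow> real \<Rightarrow> complex set" where
  "crescent p k = {w \<in> unit_disk. Re (cayley p w) < k}"

text \<open>The right-hand side is the Poisson kernel with pole \<open>p\<close>, whose level sets
  in the disk are the horocycles at \<open>p\<close>.\<close>

lemma Re_cayley:
  assumes "cmod p = 1"
  shows "Re (cayley p w) = (1 - (cmod w)\<^sup>2) / (cmod (p - w))\<^sup>2"
proof -
  have "(Re p)\<^sup>2 + (Im p)\<^sup>2 = 1" using assms by (metis cmod_power2 one_power2)
  then show ?thesis
    unfolding cayley_def Re_divide cmod_power2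
    by (auto simp: algebra_simps power2_eq_square intro!: arg_cong2[where f = "(/)"])
qed

lemma unit_disk_neq: "\<lbrakk>cmod p = 1; w \<in> unit_disk\<rbrakk> \<Longrightarrow> p \<noteq> w"
  by auto

lemma Re_cayley_pos:
  assumes "cmod p = 1" "w \<in> unit_disk"
  shows "0 < Re (cayley p w)"
  using assms unit_disk_neq[OF assms] by (auto simp: Re_cayley abs_square_less_1 intro!: divide_pos_pos)

lemma cayley_surj:
  assumes "cmod p = 1" "0 < Re u"
  obtains w where "w \<in> unit_disk" "cayley p w = u"
proof
  \<comment> \<open>Solution of (p + w) / (p - w) = u. It lies in the disk because a point of the
    right half plane is closer to 1 than to -1.\<close>
  define w where "w = p * (u - 1) / (u + 1)"
  have u1: "u + 1 \<noteq> 0" using assms(2) by (auto simp: complex_eq_iff)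
  have p0: "p \<noteq> 0" using assms(1) by auto
  have "(cmod (u - 1))\<^sup>2 < (cmod (u + 1))\<^sup>2"
    unfolding cmod_power2 using assms(2) by (simp add: power2_eq_square algebra_simps)
  then have "cmod (u - 1) < cmod (u + 1)" by (simp add: power2_less_imp_less)
  then show "w \<in> unit_disk"
    using u1 assms by (simp add: w_def norm_mult norm_divide divide_simps)
  have "p + w = 2 * p * u / (u + 1)" "p - w = 2 * p / (u + 1)"
    using u1 by (auto simp: w_def field_simps)
  then show "cayley p w = u"
    using u1 p0 by (simp add: cayley_def)
qed

lemma cayley_inj:
  assumes "cmod p = 1"
  shows "inj_on (cayley p) unit_disk"
proof (rule inj_onI)
  fix v w assume *: "v \<in> unit_disk" "w \<in> unit_disk" "cayley p v = cayley p w"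
  then have "p \<noteq> v" "p \<noteq> w" "p \<noteq> 0" using assms by auto
  with *(3) show "v = w" by (auto simp: cayley_def field_simps)
qed

lemma has_field_derivative_cayley:
  assumes "p \<noteq> w"
  shows "(cayley p has_field_derivative 2 * p / (p - w)\<^sup>2) (at w)"
  unfolding cayley_def using assms
  by (auto intro!: derivative_eq_intros simp: power2_eq_square)

lemma holomorphic_on_cayley:
  assumes "cmod p = 1"
  shows "cayley p holomorphic_on unit_disk"
  unfolding cayley_def using assms by (auto intro!: holomorphic_intros)

text \<open>Tangency puts the centre at (1 - r) times the point of tangency. The power of
  \<open>w\<close> with respect to the circle is then a positive multiple of k - Re (cayley w), so
  its sign decides on which side of the horocycle \<open>w\<close> lies.\<close>

lemma horodisk_cayley:
  assumes "horodisk H"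
  obtains p k where "cmod p = 1" "0 < k"
    "\<And>w. w \<in> unit_disk \<Longrightarrow> w \<in> closure H \<longleftrightarrow> k \<le> Re (cayley p w)"
    "\<And>w. w \<in> unit_disk \<Longrightarrow> w \<in> frontier H \<longleftrightarrow> k = Re (cayley p w)"
proof -
  obtain c r p where r: "r > 0" "H = ball c r" "H \<subseteq> unit_disk"
    and p: "p \<in> sphere c r \<inter> sphere 0 1"
    and uniq: "\<And>q. q \<in> sphere c r \<inter> sphere 0 1 \<Longrightarrow> q = p"
    using assms unfolding horodisk_def by metis
  have cr: "cmod c + r \<le> 1"
    using r ball_subset_ball_iff[of c r 0 1] by (auto simp: dist_norm)
  have p1: "cmod p = 1" and pc: "cmod (c - p) = r" using p by (auto simp: dist_norm)
  \<comment> \<open>A disk centred at 0 would be the unit disk itself, whose circle also contains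
    \<open>-p\<close>.\<close>
  have c0: "c \<noteq> 0"
  proof
    assume "c = 0"
    then have "r = 1" using pc p1 by simp
    then have "- p = p" using uniq[of "-p"] \<open>c = 0\<close> p1 by simp
    then show False using p1 by auto
  qed
  have "1 \<le> cmod c + r"
    using norm_triangle_sub[of p c] p1 pc by (simp add: norm_minus_commute)
  then have cr1: "cmod c = 1 - r" using cr by simp
  \<comment> \<open>The point of tangency, expressed through the centre so that \<open>cq\<close> is
    immediate.\<close>
  define q where "q = c / of_real (cmod c)"
  have q1: "cmod q = 1" using c0 by (simp add: q_def norm_divide)
  have cq: "c = of_real (1 - r) * q" using c0 by (simp add: q_def flip: cr1)
  \<comment> \<open>The value of Re (cayley q) at (1 - 2r) q, the point of the circle opposite
    \<open>q\<close>.\<close>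
  define k where "k = (1 - r) / r"
  have key: "(dist c w)\<^sup>2 - r\<^sup>2 = (cmod (q - w))\<^sup>2 * r * (k - Re (cayley q w))"
    if "w \<in> unit_disk" for w
  proof -
    have q2: "Re q * Re q + Im q * Im q = 1"
      using q1 by (metis cmod_power2 one_power2 power2_eq_square)
    have ne: "q \<noteq> w" using unit_disk_neq[OF q1 that] .
    have rk: "r * k = 1 - r" using r by (simp add: k_def)
    have "(cmod (q - w))\<^sup>2 * r * (k - Re (cayley q w))
        = (cmod (q - w))\<^sup>2 * (r * k) - r * (1 - (cmod w)\<^sup>2)"
      using ne by (simp add: Re_cayley[OF q1] field_simps)
    also have "\<dots> = (cmod (q - w))\<^sup>2 * (1 - r) - r * (1 - (cmod w)\<^sup>2)" by (simp add: rk)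
    also have "\<dots> = (dist c w)\<^sup>2 - r\<^sup>2"
      unfolding dist_norm cmod_power2 cq using q2
      by (simp add: power2_eq_square) algebra
    finally show ?thesis ..
  qed
  have pos: "0 < (cmod (q - w))\<^sup>2 * r" if "w \<in> unit_disk" for w
    using unit_disk_neq[OF q1 that] r by simp
  show ?thesis
  proof
    show "cmod q = 1" by fact
    show "0 < k" using r cr1 c0 by (metis divide_pos_pos k_def zero_less_norm_iff)
    fix w assume w: "w \<in> unit_disk"
    have "w \<in> closure H \<longleftrightarrow> (dist c w)\<^sup>2 - r\<^sup>2 \<le> 0"
      using r by (simp add: power2_le_iff_abs_le)
    also have "\<dots> \<longleftrightarrow> k \<le> Re (cayley q w)"
      unfolding key[OF w] using mult_le_cancel_left_pos[OF pos[OF w], of _ 0] by simp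
    finally show "w \<in> closure H \<longleftrightarrow> k \<le> Re (cayley q w)" .
    have "w \<in> frontier H \<longleftrightarrow> (dist c w)\<^sup>2 - r\<^sup>2 = 0"
      using r by (simp add: power2_eq_iff_nonneg)
    also have "\<dots> \<longleftrightarrow> k = Re (cayley q w)"
      unfolding key[OF w] using pos[OF w] by auto
    finally show "w \<in> frontier H \<longleftrightarrow> k = Re (cayley q w)" .
  qed
qed

section \<open>Hyperbolic distance in half-plane coordinates\<close>

text \<open>Numerator and denominator on the right acquire factors of the same modulus, 2 / (|p - z|
  |p - w|), which cancel.\<close>

lemma pseudo_hyperbolic_cayley:
  assumes "cmod p = 1" "z \<in> unit_disk" "w \<in> unit_disk"
  shows "cmod ((z - w) / (1 - cnj z * w))
       = cmod (cayley p z - cayley p w) / cmod (cnj (cayley p z) + cayley p w)"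
proof -
  have ne: "p - z \<noteq> 0" "p - w \<noteq> 0" "cnj p - cnj z \<noteq> 0"
    using unit_disk_neq[OF assms(1)] assms by (auto simp flip: complex_cnj_diff)
  have pp: "p * cnj p = 1" using assms(1) by (simp add: complex_norm_square[symmetric])
  have 1: "cayley p z - cayley p w = 2 * p * (z - w) / ((p - z) * (p - w))"
    using ne by (simp add: cayley_def field_simps)
  have "(cnj p + cnj z) * (p - w) + (p + w) * (cnj p - cnj z) = 2 * (1 - cnj z * w)"
    using pp by algebra
  then have 2: "cnj (cayley p z) + cayley p w = 2 * (1 - cnj z * w) / (cnj (p - z) * (p - w))"
    using ne by (simp add: cayley_def add_frac_eq)
  show ?thesis
    unfolding 1 2 using ne assms(1) by (simp add: norm_mult norm_divide del: complex_cnj_diff right_diff_distrib_numeral)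
qed

lemma artanh_diff_over_sum:
  fixes a b :: real
  assumes "0 < a" "a \<le> b"
  shows "artanh ((b - a) / (b + a)) = ln (b / a) / 2"
proof -
  have "1 + (b - a) / (b + a) = 2 * b / (b + a)" "1 - (b - a) / (b + a) = 2 * a / (b + a)"
    using assms by (auto simp: field_simps)
  then show ?thesis using assms by (simp add: artanh_def)
qed

lemma artanh_real_mono:
  fixes x y :: real
  assumes "0 \<le> x" "x \<le> y" "y < 1"
  shows "artanh x \<le> artanh y"
proof -
  have "(1 + x) / (1 - x) \<le> (1 + y) / (1 - y)"
    using assms by (intro frac_le) auto
  moreover have "0 < (1 + x) / (1 - x)" "0 < (1 + y) / (1 - y)" using assms by auto
  ultimately show ?thesis by (simp add: artanh_def)
qed

lemma pseudo_hyperbolic_less_1: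
  assumes "z \<in> unit_disk" "w \<in> unit_disk"
  shows "cmod ((z - w) / (1 - cnj z * w)) < 1"
  using Moebius_function_norm_lt_1[of z w 0] assms
  by (simp add: Moebius_function_simple norm_divide norm_minus_commute)

text \<open>Among pairs of points on two given vertical lines of the half plane, those at equal
  height are closest, and their distance is half the logarithm of the ratio of the real
  parts.\<close>

lemma hyp_dist_ge_ln:
  assumes "cmod p = 1" "z \<in> unit_disk" "w \<in> unit_disk" "Re (cayley p z) \<le> Re (cayley p w)"
  shows "ln (Re (cayley p w) / Re (cayley p z)) / 2 \<le> hyp_dist z w"
proof -
  define a b d where "a = Re (cayley p z)" and "b = Re (cayley p w)"
    and "d = Im (cayley p z) - Im (cayley p w)"
  have ab: "0 < a" "a \<le> b" using Re_cayley_pos assms by (auto simp: a_def b_def)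
  \<comment> \<open>Adding the same \<open>d\<^sup>2\<close> to numerator and denominator does not
    decrease a quotient that is at most 1.\<close>
  have "(b - a)\<^sup>2 * ((b + a)\<^sup>2 + d\<^sup>2) \<le> (b + a)\<^sup>2 * ((b - a)\<^sup>2 + d\<^sup>2)"
  proof -
    have "(b - a)\<^sup>2 \<le> (b + a)\<^sup>2" using ab by (intro power_mono) auto
    then have "(b - a)\<^sup>2 * d\<^sup>2 \<le> (b + a)\<^sup>2 * d\<^sup>2" by (rule mult_right_mono) simp
    then show ?thesis by (simp add: algebra_simps)
  qed
  moreover have "0 < (b + a)\<^sup>2" using ab by simp
  ultimately have "(b - a)\<^sup>2 / (b + a)\<^sup>2 \<le> ((b - a)\<^sup>2 + d\<^sup>2) / ((b + a)\<^sup>2 + d\<^sup>2)"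
    by (simp add: divide_simps mult.commute add_pos_nonneg)
  also have "\<dots> = (cmod ((z - w) / (1 - cnj z * w)))\<^sup>2"
    unfolding pseudo_hyperbolic_cayley[OF assms(1-3)] power_divide cmod_power2
    by (simp add: a_def b_def d_def power2_commute add.commute)
  finally have "((b - a) / (b + a))\<^sup>2 \<le> (cmod ((z - w) / (1 - cnj z * w)))\<^sup>2"
    by (simp add: power_divide)
  then have "(b - a) / (b + a) \<le> cmod ((z - w) / (1 - cnj z * w))"
    by (rule power2_le_imp_le) simp
  then have "artanh ((b - a) / (b + a)) \<le> hyp_dist z w"
    unfolding hyp_dist_def using ab pseudo_hyperbolic_less_1 assms
    by (intro artanh_real_mono) auto
  then show ?thesis
    using ab by (simp add: artanh_diff_over_sum a_def b_def)
qed

lemma hyp_dist_eq_ln: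
  assumes "cmod p = 1" "z \<in> unit_disk" "w \<in> unit_disk" "Re (cayley p z) \<le> Re (cayley p w)"
    and "Im (cayley p z) = Im (cayley p w)"
  shows "hyp_dist z w = ln (Re (cayley p w) / Re (cayley p z)) / 2"
proof -
  define a b where "a = Re (cayley p z)" and "b = Re (cayley p w)"
  have ab: "0 < a" "a \<le> b" using Re_cayley_pos assms by (auto simp: a_def b_def)
  have 1: "cayley p z - cayley p w = of_real (a - b)"
    "cnj (cayley p z) + cayley p w = of_real (b + a)"
    using assms by (auto simp: complex_eq_iff a_def b_def)
  have "cmod ((z - w) / (1 - cnj z * w)) = (b - a) / (b + a)"
    unfolding pseudo_hyperbolic_cayley[OF assms(1-3)] 1 norm_of_real using ab by simp
  then show ?thesis unfolding hyp_dist_def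
    using artanh_diff_over_sum[OF ab] by (simp add: a_def b_def)
qed

section \<open>The function h and its monotonicity\<close>

text \<open>With exp (2t) = b / a, \<open>h\<close> is sin x / x at x = pi / exp (2t); this turns
  the constant for the crescent into a function of distance.\<close>

lemma h_ln:
  assumes "0 < a" "0 < b"
  shows "h (ln (b / a) / 2) = sin (pi * a / b) / (pi * a / b)"
  using assms by (simp add: h_def field_simps)

text \<open>The derivative has the sign of t cos t - sin t. Its negative vanishes at 0 and has
  derivative s sin s, which is nonnegative up to pi.\<close>

lemma sin_over_id_antimono:
  fixes x y :: real
  assumes "0 < x" "x \<le> y" "y \<le> pi"
  shows "sin y / y \<le> sin x / x"
proof (rule DERIV_nonpos_imp_nonincreasing[where f = "\<lambda>s. sin s / s" and a = x and b = y])
  show "x \<le> y" by fact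
next
  fix t assume t: "x \<le> t" "t \<le> y"
  have "(\<lambda>s. sin s - s * cos s) 0 \<le> (\<lambda>s. sin s - s * cos s) t"
  proof (rule DERIV_nonneg_imp_nondecreasing[where f = "\<lambda>s. sin s - s * cos s" and a = 0 and b = t])
    show "0 \<le> t" using t assms by simp
  next
    fix s assume s: "0 \<le> s" "s \<le> t"
    have "((\<lambda>s. sin s - s * cos s) has_real_derivative s * sin s) (at s)"
      by (auto intro!: derivative_eq_intros simp: algebra_simps)
    moreover have "0 \<le> s * sin s" using s t assms by (simp add: sin_ge_zero)
    ultimately show "\<exists>y. ((\<lambda>s. sin s - s * cos s) has_real_derivative y) (at s) \<and> 0 \<le> y"
      by blast
  qed
  then have "(t * cos t - sin t) / t\<^sup>2 \<le> 0" using t assms by (simp add: divide_le_0_iff)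
  moreover have "((\<lambda>s. sin s / s) has_real_derivative (t * cos t - sin t) / t\<^sup>2) (at t)"
    using t assms by (auto intro!: derivative_eq_intros simp: power2_eq_square algebra_simps)
  ultimately show "\<exists>y. ((\<lambda>s. sin s / s) has_real_derivative y) (at t) \<and> y \<le> 0" by blast
qed

text \<open>For nonnegative arguments pi / exp (2r) stays in (0, pi], where sin x / x
  decreases.\<close>

lemma h_mono:
  assumes "0 \<le> s" "s \<le> t"
  shows "h s \<le> h t"
proof -
  have *: "h r = sin (pi / exp (2 * r)) / (pi / exp (2 * r))" for r
    by (simp add: h_def)
  have "1 \<le> exp (2 * s)" using assms by simp
  then show ?thesis
    unfolding * using assms by (intro sin_over_id_antimono) (auto simp: field_simps)
qed

section \<open>Riemann map and Schwarz-Pick inequality of a crescent\<close>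

lemma strip_to_half_plane:
  assumes "cmod p = 1" "w \<in> crescent p k"
  shows "0 < Im (exp (\<i> * pi / k * cayley p w))"
proof -
  have "0 < Re (cayley p w)" "Re (cayley p w) < k"
    using assms Re_cayley_pos by (auto simp: crescent_def)
  then have "0 < sin (pi * Re (cayley p w) / k)"
    by (intro sin_gt_zero) (auto simp: field_simps)
  then show ?thesis by (simp add: Im_exp)
qed

text \<open>\<open>E\<close> maps the crescent onto the upper half plane, and a Moebius map then
  sends \<open>e\<close> to 0. The derivative of \<open>F\<close> at \<open>w0\<close> has modulus
  |E'| / (2 Im e), where Im e = |e| sin x; the factor |e| cancels and leaves x / sin x.\<close>

lemma crescent_riemann_map:
  assumes p: "cmod p = 1" and k: "0 < k" and w0: "w0 \<in> crescent p k"
    and x: "x = pi * Re (cayley p w0) / k"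
  obtains F where "conformal_onto F (crescent p k) unit_disk" "F w0 = 0" "F field_differentiable at w0"
    "cmod (deriv F w0) * (1 - (cmod w0)\<^sup>2) * (sin x / x) = 1"
proof -
  define E where "E w = exp (\<i> * pi / k * cayley p w)" for w
  define e where "e = E w0"
  define F where "F w = (E w - e) / (E w - cnj e)" for w
  have ImE: "0 < Im (E w)" if "w \<in> crescent p k" for w
    using strip_to_half_plane[OF p that] by (simp add: E_def)
  have Ime: "0 < Im e" using ImE[OF w0] by (simp add: e_def)
  have ne: "E w - cnj e \<noteq> 0" if "w \<in> crescent p k" for w
    using ImE[OF that] Ime by (auto simp: complex_eq_iff)
  have sub: "crescent p k \<subseteq> unit_disk" by (auto simp: crescent_def)
  have Ehol: "E holomorphic_on crescent p k"
    unfolding E_def using holomorphic_on_cayley[OF p] sub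
    by (auto intro!: holomorphic_intros intro: holomorphic_on_subset)
  have Fhol: "F holomorphic_on crescent p k"
    unfolding F_def using Ehol ne by (auto intro!: holomorphic_intros)
  have range: "F w \<in> unit_disk" if "w \<in> crescent p k" for w
  proof -
    \<comment> \<open>The two squares differ by 4 Im (E w) Im e.\<close>
    have "(cmod (E w - e))\<^sup>2 < (cmod (E w - cnj e))\<^sup>2"
      unfolding cmod_power2 using mult_pos_pos[OF ImE[OF that] Ime]
      by (simp add: power2_eq_square algebra_simps)
    then have "cmod (E w - e) < cmod (E w - cnj e)" by (simp add: power2_less_imp_less)
    then show ?thesis using ne[OF that] by (simp add: F_def norm_divide)
  qed
  have Finj: "inj_on F (crescent p k)"
  proof (rule inj_onI)
    fix v w assume v: "v \<in> crescent p k" and w: "w \<in> crescent p k" and eq: "F v = F w"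
    have "(E v - e) * (E w - cnj e) = (E w - e) * (E v - cnj e)"
      using eq ne[OF v] ne[OF w] by (simp add: F_def frac_eq_eq)
    then have "(e - cnj e) * (E v - E w) = 0" by algebra
    moreover have "e - cnj e \<noteq> 0" using Ime by (auto simp: complex_eq_iff)
    ultimately have "E v = E w" by simp
    \<comment> \<open>The exponent has imaginary part in (0, pi), inside the principal branch, so
      \<open>Ln\<close> undoes the exponential.\<close>
    moreover have "Ln (E u) = \<i> * pi / k * cayley p u" if "u \<in> crescent p k" for u
    proof -
      have "0 < Re (cayley p u)" "Re (cayley p u) < k"
        using that Re_cayley_pos[OF p, of u] by (auto simp: crescent_def)
      then have "0 < pi * Re (cayley p u) / k" "pi * Re (cayley p u) / k < pi"
        by (auto simp: field_simps)
      then show ?thesis unfolding E_def by (intro Ln_exp) auto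
    qed
    ultimately have "\<i> * pi / k * cayley p v = \<i> * pi / k * cayley p w"
      using v w by metis
    then have "cayley p v = cayley p w" using k by simp
    then show "v = w" using cayley_inj[OF p] v w sub by (meson inj_onD subsetD)
  qed
  have onto: "unit_disk \<subseteq> F ` crescent p k"
  proof
    fix \<zeta> assume z: "\<zeta> \<in> unit_disk"
    then have z1: "1 - \<zeta> \<noteq> 0" by auto
    \<comment> \<open>Solution of (\<eta> - e) / (\<eta> - cnj e) = \<zeta>.\<close>
    define \<eta> where "\<eta> = (e - cnj e * \<zeta>) / (1 - \<zeta>)"
    have "Im \<eta> = Im e * (1 - (cmod \<zeta>)\<^sup>2) / (cmod (1 - \<zeta>))\<^sup>2"
      unfolding \<eta>_def Im_divide cmod_power2
      by (auto simp: algebra_simps power2_eq_square intro!: arg_cong2[where f = "(/)"])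
    moreover have "0 < 1 - (cmod \<zeta>)\<^sup>2" using z by (simp add: abs_square_less_1)
    ultimately have eta: "0 < Im \<eta>" using Ime z1 by simp
    then have e0: "\<eta> \<noteq> 0" by auto
    have L: "0 < Im (Ln \<eta>)" "Im (Ln \<eta>) < pi" using eta e0 Im_Ln_pos_lt_imp Im_Ln_pos_lt by auto
    \<comment> \<open>Solution of exp (i pi u / k) = \<eta>; its real part is k / pi times the
      argument of \<eta>, hence lies in the strip.\<close>
    define u where "u = of_real (k / pi) * (- \<i> * Ln \<eta>)"
    have Reu: "Re u = k / pi * Im (Ln \<eta>)" by (simp add: u_def)
    have "0 < Re u" using L k by (simp add: Reu)
    then obtain w where w: "w \<in> unit_disk" "cayley p w = u" using cayley_surj[OF p] by blast
    have "Re u < k" using L k by (simp add: Reu field_simps)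
    then have wC: "w \<in> crescent p k" using w by (simp add: crescent_def)
    have "\<i> * pi / k * u = Ln \<eta>" using k by (simp add: u_def field_simps)
    then have "E w = \<eta>" using w e0 by (simp add: E_def)
    moreover have "(\<eta> - e) = \<zeta> * (\<eta> - cnj e)"
      unfolding \<eta>_def using z1 by (simp add: field_simps)
    ultimately have "F w = \<zeta>" using ne[OF wC] by (simp add: F_def)
    then show "\<zeta> \<in> F ` crescent p k" using wC by blast
  qed
  have w0D: "w0 \<in> unit_disk" using w0 sub by auto
  have pw: "p \<noteq> w0" using unit_disk_neq[OF p w0D] .
  define E' where "E' = e * (\<i> * pi / k * (2 * p / (p - w0)\<^sup>2))"
  have dE: "(E has_field_derivative E') (at w0)"
    unfolding E_def E'_def e_def
    using has_field_derivative_cayley[OF pw] k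
    by (auto intro!: derivative_eq_intros simp: mult_ac)
  have "(F has_field_derivative (E' * (e - cnj e)) / (e - cnj e)\<^sup>2) (at w0)"
    unfolding F_def using dE ne[OF w0]
    by (auto intro!: derivative_eq_intros simp: e_def power2_eq_square)
  moreover have "e - cnj e \<noteq> 0" using ne[OF w0] by (simp add: e_def)
  ultimately have dF: "(F has_field_derivative E' / (e - cnj e)) (at w0)"
    by (simp add: power2_eq_square)
  define y where "y = Re (cayley p w0)"
  have y: "0 < y" "y < k" using w0 Re_cayley_pos[OF p w0D] by (auto simp: y_def crescent_def)
  have pos: "0 < 1 - (cmod w0)\<^sup>2" using w0D by (simp add: abs_square_less_1)
  have ce: "cmod (e - cnj e) = 2 * (cmod e * sin x)"
  proof -
    have "e - cnj e = of_real (2 * Im e) * \<i>" by (simp add: complex_eq_iff)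
    then have "cmod (e - cnj e) = \<bar>2 * Im e\<bar>" by (metis norm_mult norm_of_real norm_ii mult.right_neutral)
    moreover have "Im e = cmod e * sin x"
      by (simp add: e_def E_def x Im_exp)
    ultimately show ?thesis using Ime by simp
  qed
  have x0: "0 < x" "x < pi" using y k by (auto simp: x y_def field_simps)
  have sx: "0 < sin x" using x0 by (simp add: sin_gt_zero)
  have e0: "0 < cmod e" using Ime by auto
  \<comment> \<open>The Poisson kernel formula, solved for |p - w0|, removes \<open>p\<close> from
    the modulus of the derivative.\<close>
  have yy: "(cmod (p - w0))\<^sup>2 = (1 - (cmod w0)\<^sup>2) / y"
    using Re_cayley[OF p, of w0] pw pos y by (simp add: y_def field_simps)
  have "cmod E' = cmod e * (pi / k * (2 / (cmod (p - w0))\<^sup>2))"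
    using p k by (simp add: E'_def norm_mult norm_divide norm_power)
  also have "\<dots> = cmod e * (2 * x / (1 - (cmod w0)\<^sup>2))"
    unfolding yy using y k by (simp add: x y_def)
  finally have "cmod (E' / (e - cnj e)) = x / (1 - (cmod w0)\<^sup>2) / sin x"
    unfolding norm_divide ce using e0 sx by simp
  then have "cmod (deriv F w0) * (1 - (cmod w0)\<^sup>2) * (sin x / x) = 1"
    using DERIV_imp_deriv[OF dF] pos sx x0 by simp
  moreover have "conformal_onto F (crescent p k) unit_disk"
    unfolding conformal_onto_def using Fhol Finj onto range by blast
  moreover have "F w0 = 0" by (simp add: F_def e_def)
  ultimately show ?thesis using that dF field_differentiable_def by blast
qed

text \<open>\<open>F \<circ> f\<close> is a self-map of the disk vanishing at \<open>z\<close>, and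
  the normalisation of the derivative of \<open>F\<close> converts its Schwarz bound into sin x / x.
  Equality transfers because \<open>F\<close> is a bijection.\<close>

lemma crescent_Schwarz_Pick:
  assumes p: "cmod p = 1" and k: "0 < k" and f: "f holomorphic_on unit_disk"
    and fC: "f ` unit_disk \<subseteq> crescent p k" and z: "z \<in> unit_disk"
    and x: "x = pi * Re (cayley p (f z)) / k"
  defines "L \<equiv> (1 - (cmod z)\<^sup>2) * (cmod (deriv f z) / (1 - (cmod (f z))\<^sup>2))"
  shows "L \<le> sin x / x"
    and "L = sin x / x \<longleftrightarrow> conformal_onto f unit_disk (crescent p k)"
proof -
  have fz: "f z \<in> crescent p k" using fC z by blast
  then have fzD: "f z \<in> unit_disk" and y: "Re (cayley p (f z)) < k" by (auto simp: crescent_def)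
  obtain F where F: "conformal_onto F (crescent p k) unit_disk" "F (f z) = 0"
    "F field_differentiable at (f z)"
    "cmod (deriv F (f z)) * (1 - (cmod (f z))\<^sup>2) * (sin x / x) = 1"
    using crescent_riemann_map[OF p k fz x] by blast
  have Fhol: "F holomorphic_on crescent p k" and Finj: "inj_on F (crescent p k)"
    and Fonto: "F ` crescent p k = unit_disk"
    using F(1) by (auto simp: conformal_onto_def)
  define g where "g = F \<circ> f"
  have ghol: "g holomorphic_on unit_disk"
    unfolding g_def using f Fhol fC by (rule holomorphic_on_compose_gen)
  have gD: "g ` unit_disk \<subseteq> unit_disk"
    unfolding g_def image_comp[symmetric] using image_mono[OF fC, of F] Fonto by simp
  have g0: "g z = 0" using F(2) by (simp add: g_def)
  have "f field_differentiable at z"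
    using f z holomorphic_on_imp_differentiable_at open_ball by blast
  then have dg: "deriv g z = deriv F (f z) * deriv f z"
    unfolding g_def using F(3) by (rule deriv_chain)
  define M where "M = (1 - (cmod z)\<^sup>2) * cmod (deriv g z)"
  have pos: "0 < 1 - (cmod (f z))\<^sup>2" using fzD by (simp add: abs_square_less_1)
  have x0: "0 < x" "x < pi"
    using Re_cayley_pos[OF p fzD] y k by (auto simp: x field_simps)
  then have sx: "0 < sin x / x" by (simp add: sin_gt_zero)
  have L: "L = M * (sin x / x)"
  proof -
    \<comment> \<open>The last factor on the right equals 1 by \<open>F(4)\<close>.\<close>
    have "M * (sin x / x) = (1 - (cmod z)\<^sup>2) * (cmod (deriv f z) / (1 - (cmod (f z))\<^sup>2))
        * (cmod (deriv F (f z)) * (1 - (cmod (f z))\<^sup>2) * (sin x / x))"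
      using pos by (simp add: M_def dg norm_mult)
    then show ?thesis unfolding F(4) L_def by simp
  qed
  note SP = Schwarz_Pick_at_zero[OF ghol gD z g0, folded M_def]
  show "L \<le> sin x / x"
    unfolding L using mult_right_mono[OF SP(1), of "sin x / x"] sx by simp
  have "L = sin x / x \<longleftrightarrow> M = 1" unfolding L using sx by (metis less_irrefl mult_cancel_right1)
  also have "\<dots> \<longleftrightarrow> conformal_onto g unit_disk unit_disk" by (rule SP(2))
  also have "\<dots> \<longleftrightarrow> conformal_onto f unit_disk (crescent p k)"
  proof
    assume "conformal_onto g unit_disk unit_disk"
    then have gi: "inj_on g unit_disk" and go: "F ` (f ` unit_disk) = F ` crescent p k"
      unfolding Fonto by (auto simp: conformal_onto_def g_def image_comp)
    \<comment> \<open>Injectivity of \<open>F\<close> on the crescent cancels it from the equality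
      of images.\<close>
    have "f ` unit_disk = crescent p k"
      using go inj_on_image_eq_iff[OF Finj fC subset_refl] by simp
    moreover have "inj_on f unit_disk" using gi inj_on_imageI2 unfolding g_def by blast
    ultimately show "conformal_onto f unit_disk (crescent p k)" using f by (simp add: conformal_onto_def)
  next
    assume "conformal_onto f unit_disk (crescent p k)"
    then have fi: "inj_on f unit_disk" and fo: "f ` unit_disk = crescent p k"
      by (auto simp: conformal_onto_def)
    have "inj_on g unit_disk" unfolding g_def using fi Finj by (intro comp_inj_on) (simp_all add: fo)
    moreover have "g ` unit_disk = unit_disk" unfolding g_def image_comp[symmetric] by (simp add: fo Fonto)
    ultimately show "conformal_onto g unit_disk unit_disk" using ghol by (simp add: conformal_onto_def)
  qed
  finally show "L = sin x / x \<longleftrightarrow> conformal_onto f unit_disk (crescent p k)" .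
qed

section \<open>Hyperbolic distance to the boundary\<close>

text \<open>The pseudo-hyperbolic distance from \<open>w\<close> is continuous on the closed disk,
  so it has a minimum on the compact frontier. It equals 1 on the unit circle and is smaller at some
  frontier point inside, so the minimiser lies in the open disk.\<close>

lemma hyp_dist_boundary_attained:
  assumes "open G" "G \<subseteq> unit_disk" "G \<noteq> unit_disk" "w \<in> G"
  obtains \<omega> where "\<omega> \<in> unit_disk \<inter> frontier G" "hyp_dist_boundary G w = hyp_dist w \<omega>"
    "\<And>\<omega>'. \<omega>' \<in> unit_disk \<inter> frontier G \<Longrightarrow> hyp_dist w \<omega> \<le> hyp_dist w \<omega>'"
proof -
  have wD: "w \<in> unit_disk" using assms by auto
  \<comment> \<open>Connectedness of the disk: it meets both \<open>G\<close> and its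
    complement.\<close>
  have "unit_disk \<inter> frontier G \<noteq> {}"
    using assms by (intro connected_Int_frontier) auto
  then obtain a where a: "a \<in> unit_disk" "a \<in> frontier G" by auto
  have "bounded G" using assms(2) bounded_ball bounded_subset by blast
  then have cpt: "compact (frontier G)" by (rule compact_frontier_bounded)
  have sub: "frontier G \<subseteq> cball 0 1"
    using closure_mono[OF assms(2)] by (auto simp: frontier_def)
  define \<delta> where "\<delta> v = cmod ((w - v) / (1 - cnj w * v))" for v
  have ne: "1 - cnj w * v \<noteq> 0" if "v \<in> cball 0 1" for v
  proof
    assume "1 - cnj w * v = 0"
    then have "cnj w * v = 1" by simp
    then have "cmod w * cmod v = 1" by (metis complex_mod_cnj norm_mult norm_one)
    moreover have "cmod w * cmod v \<le> cmod w" using that by (simp add: mult_left_le)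
    ultimately show False using wD by simp
  qed
  have "continuous_on (frontier G) \<delta>"
    unfolding \<delta>_def using ne sub by (intro continuous_intros) auto
  then obtain \<omega> where om: "\<omega> \<in> frontier G" and min: "\<And>v. v \<in> frontier G \<Longrightarrow> \<delta> \<omega> \<le> \<delta> v"
    using continuous_attains_inf[OF cpt] a by blast
  have "\<delta> v = 1" if "cmod v = 1" for v
  proof -
    have "v * cnj v = 1" using that by (simp add: complex_norm_square[symmetric])
    then have "w - v = - v * cnj (1 - cnj w * v)" by (simp add: algebra_simps)
    then have "cmod (w - v) = cmod (1 - cnj w * v)"
      using that by (metis complex_mod_cnj mult_1 norm_minus_cancel norm_mult)
    then show ?thesis using ne[of v] that by (simp add: \<delta>_def norm_divide)
  qed
  moreover have "\<delta> \<omega> < 1"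
    using min[OF a(2)] pseudo_hyperbolic_less_1[OF wD a(1)] by (simp add: \<delta>_def)
  ultimately have "cmod \<omega> \<noteq> 1" by force
  then have omD: "\<omega> \<in> unit_disk" using om sub by auto
  have le: "hyp_dist w \<omega> \<le> hyp_dist w v" if "v \<in> unit_disk \<inter> frontier G" for v
    using that min[of v] pseudo_hyperbolic_less_1[OF wD, of v]
    unfolding hyp_dist_def \<delta>_def by (intro artanh_real_mono) auto
  have "hyp_dist_boundary G w = hyp_dist w \<omega>"
    unfolding hyp_dist_boundary_def using om omD le by (intro cInf_eq_minimum) auto
  then show ?thesis using that om omD le by blast
qed

text \<open>Needed for sharpness: the distance to the horocycle is a lower bound, and it is attained
  at the horizontal projection onto the line Re u = k.\<close>

lemma hyp_dist_boundary_crescent: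
  assumes H: "horodisk H" "G = unit_disk - closure H" and p: "cmod p = 1"
    and cl: "\<And>w. w \<in> unit_disk \<Longrightarrow> w \<in> closure H \<longleftrightarrow> k \<le> Re (cayley p w)"
    and fr: "\<And>w. w \<in> unit_disk \<Longrightarrow> w \<in> frontier H \<longleftrightarrow> k = Re (cayley p w)"
    and w: "w \<in> G"
  shows "hyp_dist_boundary G w = ln (k / Re (cayley p w)) / 2"
proof -
  obtain c r where r: "r > 0" "H = ball c r" "H \<subseteq> unit_disk"
    using H(1) unfolding horodisk_def by metis
  have oG: "open G" using H(2) by auto
  have sub: "G \<subseteq> unit_disk" using H(2) by auto
  \<comment> \<open>The centre of \<open>H\<close> shows that \<open>G\<close> is a proper
    subset.\<close>
  have "c \<in> unit_disk" "c \<notin> G" using r(1) subsetD[OF r(3), of c] H(2) r(2) by auto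
  then have ne: "G \<noteq> unit_disk" by blast
  have wD: "w \<in> unit_disk" using w sub by auto
  have yk: "Re (cayley p w) < k" and y0: "0 < Re (cayley p w)"
    using w cl[OF wD] H(2) Re_cayley_pos[OF p wD] by auto
  obtain \<omega> where om: "\<omega> \<in> unit_disk \<inter> frontier G" "hyp_dist_boundary G w = hyp_dist w \<omega>"
    and min: "\<And>v. v \<in> unit_disk \<inter> frontier G \<Longrightarrow> hyp_dist w \<omega> \<le> hyp_dist w v"
    using hyp_dist_boundary_attained[OF oG sub ne w] by blast
  have "\<omega> \<notin> G" using om(1) oG by (auto simp: frontier_def interior_open)
  then have kom: "k \<le> Re (cayley p \<omega>)" using om(1) cl[of \<omega>] H(2) by auto
  have "ln (k / Re (cayley p w)) / 2 \<le> ln (Re (cayley p \<omega>) / Re (cayley p w)) / 2"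
    using kom y0 yk by (simp add: divide_simps)
  also have "\<dots> \<le> hyp_dist w \<omega>"
    using om kom yk by (intro hyp_dist_ge_ln[OF p wD]) auto
  finally have ge: "ln (k / Re (cayley p w)) / 2 \<le> hyp_dist_boundary G w" using om(2) by simp
  obtain v where v: "v \<in> unit_disk" "cayley p v = Complex k (Im (cayley p w))"
    using cayley_surj[OF p, of "Complex k (Im (cayley p w))"] y0 yk by auto
  have "v \<in> frontier H" using fr[OF v(1)] v(2) by simp
  \<comment> \<open>A ball and its closed ball have the same frontier, so \<open>v\<close> is a
    limit of points outside the closed ball; openness of the disk lets these be taken in
    \<open>G\<close>.\<close>
  then have "v \<in> frontier (- closure H)"
    using r by (simp add: frontier_complement)
  then have "v \<in> unit_disk \<inter> closure (- closure H)" using v by (simp add: frontier_def)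
  then have "v \<in> closure (unit_disk \<inter> - closure H)"
    using open_Int_closure_subset[OF open_ball] by blast
  then have "v \<in> closure G" by (simp add: H(2) Diff_eq)
  moreover have "v \<notin> G" using cl[OF v(1)] v(2) H(2) by simp
  ultimately have "v \<in> unit_disk \<inter> frontier G" using v(1) oG by (simp add: frontier_def interior_open)
  then have "hyp_dist_boundary G w \<le> hyp_dist w v" using min om(2) by simp
  also have "\<dots> = ln (k / Re (cayley p w)) / 2"
    by (subst hyp_dist_eq_ln[OF p wD v(1)]) (simp_all add: v(2) less_imp_le[OF yk])
  finally show ?thesis using ge by simp
qed

section \<open>Comparison of a horo-convex domain with a crescent\<close>

theorem corollary1:
  fixes G :: "complex set" and f :: "complex \<Rightarrow> complex" and z :: complex
  assumes "horo_convex G" and "G \<noteq> unit_disk"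
    and "f holomorphic_on unit_disk" and "f ` unit_disk \<subseteq> unit_disk"
    and "f ` unit_disk \<subseteq> G"
    and "z \<in> unit_disk"
  shows "(1 - (cmod z)\<^sup>2) * (cmod (deriv f z) / (1 - (cmod (f z))\<^sup>2))
           \<le> h (hyp_dist_boundary G (f z)) \<and>
         ((1 - (cmod z)\<^sup>2) * (cmod (deriv f z) / (1 - (cmod (f z))\<^sup>2))
           = h (hyp_dist_boundary G (f z))
          \<longleftrightarrow> horo_crescent G \<and> conformal_onto f unit_disk G)"
proof -
  define L where "L = (1 - (cmod z)\<^sup>2) * (cmod (deriv f z) / (1 - (cmod (f z))\<^sup>2))"
  have dom: "is_domain G" and oG: "open G" and sub: "G \<subseteq> unit_disk"
    using assms(1) by (auto simp: horo_convex_def is_domain_def)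
  have fz: "f z \<in> G" using assms by blast
  then have fzD: "f z \<in> unit_disk" using sub by blast
  obtain \<omega> where om: "\<omega> \<in> unit_disk \<inter> frontier G" "hyp_dist_boundary G (f z) = hyp_dist (f z) \<omega>"
    using hyp_dist_boundary_attained[OF oG sub assms(2) fz] by metis
  obtain H where H: "horodisk H" "\<omega> \<in> frontier H" "G \<inter> H = {}"
    using assms(1) om(1) unfolding horo_convex_def by blast
  obtain p k where p: "cmod p = 1" and k: "0 < k"
    and cl: "\<And>w. w \<in> unit_disk \<Longrightarrow> w \<in> closure H \<longleftrightarrow> k \<le> Re (cayley p w)"
    and fr: "\<And>w. w \<in> unit_disk \<Longrightarrow> w \<in> frontier H \<longleftrightarrow> k = Re (cayley p w)"
    using horodisk_cayley[OF H(1)] by blast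
  have C: "unit_disk - closure H = crescent p k"
    using cl by (force simp: crescent_def)
  \<comment> \<open>An open set that misses \<open>H\<close> also misses its closure.\<close>
  have "G \<inter> closure H = {}" using H(3) oG by (simp add: open_Int_closure_eq_empty)
  then have GC: "G \<subseteq> crescent p k" using sub C by blast
  then have fC: "f ` unit_disk \<subseteq> crescent p k" using assms by blast
  define x where "x = pi * Re (cayley p (f z)) / k"
  note SP = crescent_Schwarz_Pick[OF p k assms(3) fC assms(6) x_def, folded L_def]
  have y: "0 < Re (cayley p (f z))" "Re (cayley p (f z)) < k"
    using Re_cayley_pos[OF p fzD] fz GC by (auto simp: crescent_def)
  have kom: "Re (cayley p \<omega>) = k" using fr om(1) H(2) by simp
  have "sin x / x = h (ln (k / Re (cayley p (f z))) / 2)"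
    unfolding x_def by (rule h_ln[symmetric]) (use y k in auto)
  also have "\<dots> \<le> h (hyp_dist_boundary G (f z))"
  proof (rule h_mono)
    show "0 \<le> ln (k / Re (cayley p (f z))) / 2" using y by simp
    \<comment> \<open>The nearest point \<omega> lies on the horocycle, so it is at least as far
      away as the horocycle.\<close>
    show "ln (k / Re (cayley p (f z))) / 2 \<le> hyp_dist_boundary G (f z)"
      unfolding om(2) using hyp_dist_ge_ln[OF p fzD, of \<omega>] om(1) kom y by simp
  qed
  finally have hx: "sin x / x \<le> h (hyp_dist_boundary G (f z))" .
  have "L = h (hyp_dist_boundary G (f z)) \<longleftrightarrow> horo_crescent G \<and> conformal_onto f unit_disk G"
  proof
    assume "L = h (hyp_dist_boundary G (f z))"
    \<comment> \<open>The chain L \<le> sin x / x \<le> h collapses, so the equality case for the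
      crescent of \<open>H\<close> applies; its image then fills \<open>G\<close>.\<close>
    then have "conformal_onto f unit_disk (crescent p k)" using SP hx by linarith
    moreover from this have "crescent p k \<subseteq> G" using assms(5) by (simp add: conformal_onto_def)
    ultimately show "horo_crescent G \<and> conformal_onto f unit_disk G"
      using GC C dom H(1) unfolding horo_crescent_def by (metis subset_antisym)
  next
    assume *: "horo_crescent G \<and> conformal_onto f unit_disk G"
    then obtain K where K: "horodisk K" "G = unit_disk - closure K"
      by (auto simp: horo_crescent_def)
    \<comment> \<open>\<open>K\<close> is not compared with the earlier \<open>H\<close>: the
      equality case and the boundary distance are computed afresh in the coordinates of
      \<open>K\<close>.\<close>
    obtain q l where q: "cmod q = 1" and l: "0 < l"
      and clK: "\<And>w. w \<in> unit_disk \<Longrightarrow> w \<in> closure K \<longleftrightarrow> l \<le> Re (cayley q w)"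
      and frK: "\<And>w. w \<in> unit_disk \<Longrightarrow> w \<in> frontier K \<longleftrightarrow> l = Re (cayley q w)"
      using horodisk_cayley[OF K(1)] by blast
    have G: "G = crescent q l" using clK K(2) by (force simp: crescent_def)
    have "L = sin (pi * Re (cayley q (f z)) / l) / (pi * Re (cayley q (f z)) / l)"
      using crescent_Schwarz_Pick(2)[OF q l assms(3) _ assms(6) refl, folded L_def] * assms(5) G
      by simp
    also have "\<dots> = h (ln (l / Re (cayley q (f z))) / 2)"
      by (rule h_ln[symmetric]) (use Re_cayley_pos[OF q fzD] l in auto)
    also have "ln (l / Re (cayley q (f z))) / 2 = hyp_dist_boundary G (f z)"
      by (rule hyp_dist_boundary_crescent[OF K q _ _ fz, symmetric]) (use clK frK in auto)
    finally show "L = h (hyp_dist_boundary G (f z))" .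
  qed
  then show ?thesis using SP(1) hx unfolding L_def by linarith
qed

end
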